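(* Let $f$ be a transcendental entire function and let $U$ be a bounded open subset of $\mathbb{C}$. Then there exists $R>0$ such that $$S(U,f^n)\leq \log M^{n}(R,f)$$ for all $n\in\mathbb{N}$.
   Context: $f^n$ denotes the $n$-th iterate of $f$, and $\mathbb{N}=\{1,2,3,\dots\}$. For an entire function $g$, the spherical derivative is $g^\#(z)=\frac{|g'(z)|}{1+|g(z)|^2}$, and the normalized spherical area is $S(U,g)=\frac{1}{\pi}\int_U g^\#(z)^2\,dx\,dy$ (where $z=x+iy$). The maximum modulus is $M(r,f)=\max_{|z|=r}|f(z)|$, and $M^n(r,f)$ denotes its iterate with respect to the first variable: $M^1(r,f)=M(r,f)$ and $M^{n+1}(r,f)=M(M^n(r,f),f)$. *)

theory Defs
  imports "HOL-Complex_Analysis.Complex_Analysis"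
begin

text \<open>For entire functions, being transcendental means not being a polynomial.\<close>

definition transcendental_entire :: "(complex \<Rightarrow> complex) \<Rightarrow> bool" where
  "transcendental_entire f \<longleftrightarrow> f holomorphic_on UNIV \<and> \<not> (\<exists>p. f = poly p)"

definition spherical_deriv :: "(complex \<Rightarrow> complex) \<Rightarrow> complex \<Rightarrow> real" where
  "spherical_deriv g z = norm (deriv g z) / (1 + (norm (g z))\<^sup>2)"

text \<open>The measure \<open>lborel\<close> on \<open>complex\<close> is the planar measure \<open>dx dy\<close>. The Bochner integral is
  0 for a non-integrable integrand; for bounded open \<open>U\<close> and entire \<open>g\<close> this does not happen,
  see \<open>spherical_area_integrable\<close>.\<close>

definition spherical_area :: "complex set \<Rightarrow> (complex \<Rightarrow> complex) \<Rightarrow> real" where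
  "spherical_area U g = (1 / pi) * (LINT z:U|lborel. (spherical_deriv g z)\<^sup>2)"

text \<open>For continuous \<open>f\<close> and \<open>r \<ge> 0\<close> the supremum is attained, see \<open>max_modulus_attained\<close>.\<close>

definition max_modulus :: "real \<Rightarrow> (complex \<Rightarrow> complex) \<Rightarrow> real" where
  "max_modulus r f = (SUP z\<in>sphere 0 r. norm (f z))"

definition iter_max_modulus :: "nat \<Rightarrow> real \<Rightarrow> (complex \<Rightarrow> complex) \<Rightarrow> real" where
  "iter_max_modulus n r f = ((\<lambda>s. max_modulus s f) ^^ n) r"

lemma iter_max_modulus_1: "iter_max_modulus 1 r f = max_modulus r f"
  by (simp add: iter_max_modulus_def)

lemma iter_max_modulus_Suc:
  "iter_max_modulus (Suc n) r f = max_modulus (iter_max_modulus n r f) f"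
  by (simp add: iter_max_modulus_def)

lemma max_modulus_attained:
  assumes "continuous_on UNIV f" "r \<ge> 0"
  shows "\<exists>z\<in>sphere 0 r. norm (f z) = max_modulus r f \<and> (\<forall>w\<in>sphere 0 r. norm (f w) \<le> norm (f z))"
proof -
  have ne: "sphere (0::complex) r \<noteq> {}"
    using assms(2) by simp
  have "continuous_on (sphere 0 r) (\<lambda>z. norm (f z))"
    using assms(1) continuous_on_norm continuous_on_subset by blast
  then obtain z where z: "z \<in> sphere 0 r" "\<forall>w\<in>sphere 0 r. norm (f w) \<le> norm (f z)"
    using continuous_attains_sup[OF compact_sphere ne] by metis
  have "max_modulus r f = norm (f z)"
    unfolding max_modulus_def using z by (intro cSup_eq_maximum) auto
  then show ?thesis
    using z by auto
qed

lemma spherical_area_integrable: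
  assumes "g holomorphic_on UNIV" "bounded U" "open U"
  shows "set_integrable lborel U (\<lambda>z. (spherical_deriv g z)\<^sup>2)"
proof -
  have pos: "1 + (norm (g z))\<^sup>2 \<noteq> 0" for z
    using zero_le_power2[of "norm (g z)"] by linarith
  have g: "continuous_on (closure U) g"
    using holomorphic_on_imp_continuous_on[OF assms(1)] continuous_on_subset by blast
  have g': "continuous_on (closure U) (deriv g)"
    using holomorphic_on_imp_continuous_on[OF holomorphic_deriv[OF assms(1) open_UNIV]]
      continuous_on_subset by blast
  have "continuous_on (closure U) (\<lambda>z. (spherical_deriv g z)\<^sup>2)"
    unfolding spherical_deriv_def by (intro continuous_intros g g') (use pos in auto)
  moreover have "compact (closure U)"
    using assms(2) by simp
  ultimately have "set_integrable lborel (closure U) (\<lambda>z. (spherical_deriv g z)\<^sup>2)"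
    using borel_integrable_compact unfolding set_integrable_def
    by (metis (no_types, lifting) Bochner_Integration.integrable_cong indicator_simps scaleR_one scaleR_zero_left)
  then show ?thesis
    by (rule set_integrable_subset) (use assms(3) closure_subset in auto)
qed

end

theory Submission
  imports Defs
begin

text \<open>For entire \<open>g\<close> the function \<open>u = log (1 + |g|\<^sup>2)\<close> satisfies \<open>\<Delta>u = 4 (g\<^sup>#)\<^sup>2\<close>, where \<open>g\<^sup>#\<close> is the
spherical derivative. Green's formula against a test function \<open>\<phi> \<ge> 0\<close> of compact support therefore
turns spherical area into growth:
\<open>4 \<integral> \<phi> (g\<^sup>#)\<^sup>2 = \<integral> u \<Delta>\<phi> \<le> sup u \<cdot> \<integral> (\<Delta>\<phi>)\<^sup>+\<close>, the supremum being over the support of \<open>\<phi>\<close>.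
In the plane \<open>\<phi>\<close> may be arbitrarily large on a fixed disc while \<open>\<integral> (\<Delta>\<phi>)\<^sup>+\<close> stays bounded, because
the logarithm is harmonic and unbounded. The test function used here is a smoothed
truncation of \<open>log (R\<^sup>2 / (1 + |z|\<^sup>2))\<close>, supported in \<open>|z| \<le> R\<close>: its Laplacian is at most \<open>8 / R\<^sup>2\<close>
(\<open>cutoff_laplacian_le\<close>), and it is at least 8 on the disc of radius \<open>r\<close> once
\<open>exp 10 \<cdot> (1 + r\<^sup>2) \<le> R\<^sup>2\<close> (\<open>cutoff_ge\<close>). Integrating over the square of side \<open>2 R\<close> gives
\<open>\<pi> S(U, g) \<le> log (1 + M(R, g)\<^sup>2)\<close> for \<open>U\<close> inside the disc of radius \<open>r\<close>
(\<open>spherical_area_le_log\<close>). The lower bound on \<open>R\<close> involves \<open>U\<close> but not \<open>g\<close>, so one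
radius serves all iterates of \<open>f\<close>.

For \<open>g = f\<^sup>n\<close> the maximum principle gives \<open>M(R, f\<^sup>n) \<le> M\<^sup>n(R, f)\<close>. Since \<open>f\<close> is not a polynomial,
\<open>M(R, f) \<ge> R\<close> for arbitrarily large \<open>R\<close> (\<open>transcendental_max_modulus_ge\<close>), and for such \<open>R\<close> all
\<open>M = M\<^sup>n(R, f)\<close> are at least \<open>R \<ge> 2\<close>; then \<open>log (1 + M\<^sup>2) \<le> 3 log M \<le> \<pi> log M\<close>.\<close>

section \<open>The truncated logarithm\<close>

text \<open>On \<open>(0, 1]\<close> this is \<open>-log m\<close> minus its second-order Taylor polynomial at 1, so that the extension
by 0 to \<open>m \<ge> 1\<close> is twice continuously differentiable. Evaluating at \<open>min t 1\<close> performs that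
extension, the formulas for the function and its first two derivatives all vanishing at 1.\<close>

definition cutoff :: "real \<Rightarrow> real" where
  "cutoff t = (let m = min t 1 in - ln m - 3/2 + 2 * m - m\<^sup>2 / 2)"

definition cutoff' :: "real \<Rightarrow> real" where
  "cutoff' t = (let m = min t 1 in - (1 - m)\<^sup>2 / m)"

definition cutoff'' :: "real \<Rightarrow> real" where
  "cutoff'' t = (let m = min t 1 in 1 / m\<^sup>2 - 1)"

text \<open>Freezing a function beyond 1 keeps it differentiable exactly because the derivative has
already come down to 0 there. This is applied once to \<open>cutoff\<close> and once to its derivative.\<close>

lemma has_real_derivative_truncated:
  fixes h :: "real \<Rightarrow> real"
  assumes pos: "\<And>m. 0 < m \<Longrightarrow> (h has_real_derivative h' m) (at m)" and flat: "h' 1 = 0" and t: "t > 0"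
  shows "((\<lambda>t. h (min t 1)) has_real_derivative h' (min t 1)) (at t)"
proof -
  consider "t < 1" | "t = 1" | "t > 1" by linarith
  then show ?thesis
  proof cases
    case 1
    have "(h has_real_derivative h' t) (at t)" using pos t by simp
    moreover have "eventually (\<lambda>s. h s = h (min s 1)) (nhds t)"
      using eventually_nhds_in_open[of "{..<1::real}" t] 1 by (auto elim!: eventually_mono simp: min_def)
    ultimately show ?thesis using 1 DERIV_cong_ev[of t t h] by (simp add: min_def)
  next
    case 3
    have "((\<lambda>s::real. h 1) has_real_derivative 0) (at t)" by simp
    moreover have "eventually (\<lambda>s. h 1 = h (min s 1)) (nhds t)"
      using eventually_nhds_in_open[of "{1<..}" t] 3 by (auto elim!: eventually_mono simp: min_def)
    ultimately have "((\<lambda>s. h (min s 1)) has_real_derivative 0) (at t)"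
      by (subst DERIV_cong_ev[OF refl _ refl, of _ "\<lambda>s. h 1"]) (auto elim!: eventually_mono)
    then show ?thesis using 3 flat by simp
  next
    case 2
    have D: "((\<lambda>s. (h s - h 1) / (s - 1)) \<longlongrightarrow> 0) (at 1)"
      using pos[of 1] flat by (simp add: has_field_derivative_iff)
    have L: "((\<lambda>s. (h (min s 1) - h 1) / (s - 1)) \<longlongrightarrow> 0) (at_left 1)"
    proof (rule Lim_transform_eventually)
      show "((\<lambda>s. (h s - h 1) / (s - 1)) \<longlongrightarrow> 0) (at_left 1)"
        using D by (simp add: filterlim_at_split)
      show "eventually (\<lambda>s. (h s - h 1) / (s - 1) = (h (min s 1) - h 1) / (s - 1)) (at_left 1)"
        unfolding eventually_at_filter by (auto simp: min_def)
    qed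
    have R: "((\<lambda>s. (h (min s 1) - h 1) / (s - 1)) \<longlongrightarrow> 0) (at_right 1)"
    proof (rule Lim_transform_eventually[OF tendsto_const])
      show "eventually (\<lambda>s. 0 = (h (min s 1) - h 1) / (s - 1)) (at_right 1)"
        unfolding eventually_at_filter by (auto simp: min_def)
    qed
    show ?thesis
      using L R 2 flat by (simp add: has_field_derivative_iff filterlim_at_split)
  qed
qed

lemma cutoff_deriv:
  assumes "t > 0" shows "(cutoff has_real_derivative cutoff' t) (at t)"
  unfolding cutoff_def cutoff'_def Let_def
  by (rule has_real_derivative_truncated[where h = "\<lambda>m. - ln m - 3/2 + 2 * m - m\<^sup>2 / 2"])
     (use assms in \<open>auto intro!: derivative_eq_intros simp: field_simps power2_eq_square\<close>)

lemma cutoff'_deriv: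
  assumes "t > 0" shows "(cutoff' has_real_derivative cutoff'' t) (at t)"
  unfolding cutoff'_def cutoff''_def Let_def
  by (rule has_real_derivative_truncated[where h = "\<lambda>m. - (1 - m)\<^sup>2 / m"])
     (use assms in \<open>auto intro!: derivative_eq_intros simp: field_simps power2_eq_square\<close>)

lemma cutoff''_continuous: "continuous_on {0<..} cutoff''"
  unfolding cutoff''_def Let_def by (intro continuous_intros) (auto simp: min_def)

lemma cutoff_outside: "t \<ge> 1 \<Longrightarrow> cutoff t = 0" "t \<ge> 1 \<Longrightarrow> cutoff' t = 0" "t \<ge> 1 \<Longrightarrow> cutoff'' t = 0"
  by (auto simp: cutoff_def cutoff'_def cutoff''_def min_def)

lemma cutoff_nonneg:
  assumes "t > 0" shows "cutoff t \<ge> 0"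
proof (cases "t \<ge> 1")
  case False
  have "cutoff 1 \<le> cutoff t"
  proof (rule DERIV_nonpos_imp_nonincreasing[of t 1 cutoff])
    show "t \<le> 1" using False by simp
    fix x assume "t \<le> x" "x \<le> 1"
    then show "\<exists>y. (cutoff has_real_derivative y) (at x) \<and> y \<le> 0"
      using assms cutoff_deriv[of x] by (intro exI[of _ "cutoff' x"]) (auto simp: cutoff'_def)
  qed
  then show ?thesis by (simp add: cutoff_outside)
qed (simp add: cutoff_outside)

text \<open>The logarithm contributes at least 10 and the subtracted Taylor polynomial at most \<open>3/2\<close> on
\<open>(0, 1]\<close>.\<close>

lemma cutoff_ge:
  assumes "0 < t" "t \<le> exp (-10)" shows "cutoff t \<ge> 8"
proof -
  have "exp (-10::real) \<le> 1" by simp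
  then have t1: "t \<le> 1" using assms by linarith
  have "ln t \<le> -10" using assms by (metis ln_exp ln_mono)
  moreover have "t\<^sup>2 \<le> 1" using t1 assms by (simp add: power_le_one)
  ultimately show ?thesis using t1 assms by (auto simp: cutoff_def Let_def min_def)
qed

text \<open>The left-hand side is the Laplacian of \<open>z \<mapsto> cutoff ((1 + |z|\<^sup>2) / N)\<close> at a point with
\<open>q = |z|\<^sup>2\<close>. For \<open>m < 1\<close>, writing \<open>q = N m - 1\<close>, it equals \<open>(4/N) (m h'' + h') - (4/N\<^sup>2) h''\<close> with \<open>h = cutoff\<close>. Here
\<open>m h'' + h' = 2 - 2 m\<close>, as the singular terms cancel by harmonicity of the logarithm, while
\<open>h'' \<ge> 0\<close> makes the second part harmless. So the Laplacian is bounded above even though the function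
itself is of size \<open>log N\<close> near the origin.\<close>

lemma cutoff_laplacian_le:
  assumes "N > 0" "q \<ge> 0"
  defines "m \<equiv> (1 + q) / N"
  shows "cutoff'' m * (4 * q / N\<^sup>2) + cutoff' m * (4 / N) \<le> 8 / N"
proof (cases "m \<ge> 1")
  case True then show ?thesis using assms by (simp add: cutoff_outside)
next
  case False
  have m: "0 < m" "m < 1" using False assms by auto
  have q: "q = N * m - 1" using assms by (simp add: m_def)
  have "cutoff'' m * (4 * q / N\<^sup>2) + cutoff' m * (4 / N)
      = 4 / N * (m * (1 / m\<^sup>2 - 1) - (1 - m)\<^sup>2 / m) - (1 / m\<^sup>2 - 1) * (4 / N\<^sup>2)"
    using m assms unfolding q cutoff'_def cutoff''_def
    by (simp add: field_simps power2_eq_square)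
  also have "m * (1 / m\<^sup>2 - 1) - (1 - m)\<^sup>2 / m = 2 - 2 * m"
    using m by (simp add: field_simps power2_eq_square)
  also have "4 / N * (2 - 2 * m) - (1 / m\<^sup>2 - 1) * (4 / N\<^sup>2) \<le> 4 / N * 2 - 0"
  proof (rule diff_mono)
    show "4 / N * (2 - 2 * m) \<le> 4 / N * 2" using m assms by (intro mult_left_mono) auto
    have "m\<^sup>2 \<le> 1" using m by (simp add: power_le_one)
    then show "0 \<le> (1 / m\<^sup>2 - 1) * (4 / N\<^sup>2)" using m by (intro mult_nonneg_nonneg) (auto simp: field_simps)
  qed
  finally show ?thesis by simp
qed

section \<open>The Laplacian of \<open>log (1 + |g|\<^sup>2)\<close>\<close>

text \<open>Only derivatives along a curve are needed: horizontal and vertical lines in the plane are both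
covered, so the two second-order partial derivatives of \<open>log (1 + |g|\<^sup>2)\<close> come from one computation.\<close>

lemma log_one_plus_norm_derivs:
  fixes \<gamma> :: "real \<Rightarrow> 'a::real_inner"
  assumes 1: "(\<gamma> has_vector_derivative \<gamma>' t) (at t)" and 2: "(\<gamma>' has_vector_derivative \<gamma>'') (at t)"
  shows "((\<lambda>t. ln (1 + (norm (\<gamma> t))\<^sup>2)) has_real_derivative 2 * (\<gamma> t \<bullet> \<gamma>' t) / (1 + (norm (\<gamma> t))\<^sup>2)) (at t)"
    and "((\<lambda>t. 2 * (\<gamma> t \<bullet> \<gamma>' t) / (1 + (norm (\<gamma> t))\<^sup>2)) has_real_derivative
           2 * ((norm (\<gamma>' t))\<^sup>2 + \<gamma> t \<bullet> \<gamma>'') / (1 + (norm (\<gamma> t))\<^sup>2)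
           - (2 * (\<gamma> t \<bullet> \<gamma>' t) / (1 + (norm (\<gamma> t))\<^sup>2))\<^sup>2) (at t)"
proof -
  have pos: "1 + (norm v)\<^sup>2 > 0" for v :: 'a by (simp add: add_pos_nonneg)
  have sq: "((\<lambda>t. 1 + (norm (\<gamma> t))\<^sup>2) has_real_derivative 2 * (\<gamma> t \<bullet> \<gamma>' t)) (at t)"
    unfolding power2_norm_eq_inner has_real_derivative_iff_has_vector_derivative
    by (rule has_vector_derivative_eq_rhs[OF has_vector_derivative_add[OF has_vector_derivative_const
          bounded_bilinear.has_vector_derivative[OF bounded_bilinear_inner 1 1]]])
       (simp add: inner_commute)
  have ip: "((\<lambda>t. \<gamma> t \<bullet> \<gamma>' t) has_real_derivative (\<gamma> t \<bullet> \<gamma>'' + (norm (\<gamma>' t))\<^sup>2)) (at t)"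
    unfolding power2_norm_eq_inner has_real_derivative_iff_has_vector_derivative
    by (rule bounded_bilinear.has_vector_derivative[OF bounded_bilinear_inner 1 2])
  show "((\<lambda>t. ln (1 + (norm (\<gamma> t))\<^sup>2)) has_real_derivative 2 * (\<gamma> t \<bullet> \<gamma>' t) / (1 + (norm (\<gamma> t))\<^sup>2)) (at t)"
    using DERIV_chain2[OF DERIV_ln_divide[OF pos] sq] by simp
  have nz: "1 + (norm (\<gamma> t))\<^sup>2 \<noteq> 0" using pos[of "\<gamma> t"] by linarith
  have quotient: "(2 * (b + a) * D - 2 * X * (2 * X)) / (D * D) = 2 * (a + b) / D - (2 * X / D)\<^sup>2"
    if "D \<noteq> 0" for a b X D :: real
    using that by (simp add: field_simps power2_eq_square)
  show "((\<lambda>t. 2 * (\<gamma> t \<bullet> \<gamma>' t) / (1 + (norm (\<gamma> t))\<^sup>2)) has_real_derivative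
           2 * ((norm (\<gamma>' t))\<^sup>2 + \<gamma> t \<bullet> \<gamma>'') / (1 + (norm (\<gamma> t))\<^sup>2)
           - (2 * (\<gamma> t \<bullet> \<gamma>' t) / (1 + (norm (\<gamma> t))\<^sup>2))\<^sup>2) (at t)"
    by (rule DERIV_cong[OF DERIV_divide[OF DERIV_cmult[OF ip] sq nz] quotient[OF nz]])
qed

text \<open>Here \<open>a, b, c\<close> stand for \<open>g, g', g''\<close>. For holomorphic \<open>g\<close> the velocities along horizontal and vertical
lines are \<open>g'\<close> and \<open>\<i> g'\<close>, the accelerations \<open>g''\<close> and \<open>-g''\<close>; hence \<open>g''\<close> drops out of the sum, and what
remains is four times the square of the spherical derivative. The key identity is Pythagoras in the
orthogonal frame \<open>b, \<i> b\<close>.\<close>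

lemma log_one_plus_norm_laplacian:
  fixes a b c :: complex
  defines "D \<equiv> 1 + (norm a)\<^sup>2"
  shows "(2 * ((norm b)\<^sup>2 + a \<bullet> c) / D - (2 * (a \<bullet> b) / D)\<^sup>2)
       + (2 * ((norm (\<i> * b))\<^sup>2 + a \<bullet> (- c)) / D - (2 * (a \<bullet> (\<i> * b)) / D)\<^sup>2)
       = 4 * (norm b / D)\<^sup>2"
proof -
  have D: "D > 0" unfolding D_def by (simp add: add_pos_nonneg)
  have sq: "(a \<bullet> b)\<^sup>2 + (a \<bullet> (\<i> * b))\<^sup>2 = (D - 1) * (norm b)\<^sup>2"
    unfolding D_def cmod_power2 inner_complex_def by (simp add: algebra_simps power2_eq_square)
  have "(2 * ((norm b)\<^sup>2 + a \<bullet> c) / D - (2 * (a \<bullet> b) / D)\<^sup>2)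
       + (2 * ((norm (\<i> * b))\<^sup>2 + a \<bullet> (- c)) / D - (2 * (a \<bullet> (\<i> * b)) / D)\<^sup>2)
     = 4 * (norm b)\<^sup>2 / D - 4 * ((a \<bullet> b)\<^sup>2 + (a \<bullet> (\<i> * b))\<^sup>2) / D\<^sup>2"
    by (simp add: norm_mult power_divide power_mult_distrib add_divide_distrib diff_divide_distrib algebra_simps)
  also have "\<dots> = 4 * (norm b / D)\<^sup>2"
    unfolding sq using D by (simp add: field_simps power2_eq_square)
  finally show ?thesis .
qed

section \<open>Green's formula on a square\<close>

lemma green_interval:
  fixes u u' u'' p p' p'' :: "real \<Rightarrow> real"
  assumes "a \<le> b"
    and "\<And>t. (u has_real_derivative u' t) (at t)" "\<And>t. (u' has_real_derivative u'' t) (at t)"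
    and "\<And>t. (p has_real_derivative p' t) (at t)" "\<And>t. (p' has_real_derivative p'' t) (at t)"
    and "p a = 0" "p b = 0" "p' a = 0" "p' b = 0"
  shows "((\<lambda>t. u t * p'' t - p t * u'' t) has_integral 0) {a..b}"
proof -
  have "((\<lambda>t. u t * p'' t - p t * u'' t) has_integral (u b * p' b - p b * u' b) - (u a * p' a - p a * u' a)) {a..b}"
  proof (rule fundamental_theorem_of_calculus[OF assms(1)])
    fix t
    have "((\<lambda>t. u t * p' t - p t * u' t) has_real_derivative (u t * p'' t - p t * u'' t)) (at t)"
      by (rule derivative_eq_intros assms refl)+ (simp add: algebra_simps)
    then show "((\<lambda>t. u t * p' t - p t * u' t) has_vector_derivative (u t * p'' t - p t * u'' t)) (at t within {a..b})"
      by (simp add: has_real_derivative_iff_has_vector_derivative has_vector_derivative_at_within)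
  qed
  then show ?thesis using assms by simp
qed

text \<open>Planar measure is the image of the product measure on the coordinates; this is what gives access to
iterated integrals.\<close>

lemma lborel_complex: "(lborel :: complex measure) = distr lborel borel (\<lambda>(x, y). Complex x y)"
proof (rule lborel_eqI)
  have meas: "(\<lambda>(x, y). Complex x y) \<in> borel_measurable borel"
    by (intro borel_measurable_continuous_onI) (auto simp: case_prod_unfold intro!: continuous_intros)
  fix l u :: complex assume lu: "\<And>b. b \<in> Basis \<Longrightarrow> l \<bullet> b \<le> u \<bullet> b"
  have le: "Re l \<le> Re u" "Im l \<le> Im u" using lu[of 1] lu[of \<i>] by (auto simp: Basis_complex_def)
  have "emeasure (distr lborel borel (\<lambda>(x, y). Complex x y)) (box l u)
      = emeasure lborel ((\<lambda>(x, y). Complex x y) -` box l u)"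
    using meas by (subst emeasure_distr) auto
  also have "(\<lambda>(x, y). Complex x y) -` box l u = box (Re l, Im l) (Re u, Im u)"
    by (auto simp: box_def Basis_complex_def Basis_prod_def)
  also have "emeasure lborel \<dots> = ennreal (\<Prod>b\<in>Basis. (u - l) \<bullet> b)"
    using le by (subst emeasure_lborel_box) (auto simp: Basis_complex_def Basis_prod_def prod.union_disjoint)
  finally show "emeasure (distr lborel borel (\<lambda>(x, y). Complex x y)) (box l u) = ennreal (\<Prod>b\<in>Basis. (u - l) \<bullet> b)" .
qed simp

text \<open>Continuity makes the order of integration irrelevant, so the \<open>x\<close>-part and the \<open>y\<close>-part of Green's formula
can each be integrated first in its own direction, where \<open>green_interval\<close> applies.\<close>

lemma integral_square_eq_0:
  fixes A :: "real \<Rightarrow> real \<Rightarrow> real"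
  assumes cont: "continuous_on UNIV (\<lambda>(x, y). A x y)"
    and "(\<forall>y. ((\<lambda>x. A x y) has_integral 0) {a..b}) \<or> (\<forall>x. (A x has_integral 0) {a..b})"
  shows "integral (cbox (a, a) (b, b)) (\<lambda>(x, y). A x y) = 0"
proof -
  have c: "continuous_on (cbox (a, a) (b, b)) (\<lambda>(x, y). A x y)"
    using cont continuous_on_subset by blast
  have I: "integral (cbox (a, a) (b, b)) (\<lambda>(x, y). A x y) = integral {a..b} (\<lambda>x. integral {a..b} (A x))"
    using integral_prod_continuous[OF c] by simp
  have J: "integral {a..b} (\<lambda>x. integral {a..b} (A x)) = integral {a..b} (\<lambda>y. integral {a..b} (\<lambda>x. A x y))"
    using integral_swap_continuous[OF c] by simp
  from assms(2) show ?thesis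
  proof
    assume "\<forall>y. ((\<lambda>x. A x y) has_integral 0) {a..b}"
    then have "integral {a..b} (\<lambda>x. A x y) = 0" for y by (simp add: integral_unique)
    then show ?thesis using I J by simp
  next
    assume "\<forall>x. (A x has_integral 0) {a..b}"
    then have "integral {a..b} (A x) = 0" for x by (simp add: integral_unique)
    then show ?thesis using I by simp
  qed
qed

text \<open>Green's formula for \<open>u = log (1 + |g|\<^sup>2)\<close> and the truncated logarithm \<open>p\<close>, with the Laplacian bound for
\<open>p\<close>. The factor 32 is the area \<open>4 R\<^sup>2\<close> of the square times the bound \<open>8 / R\<^sup>2\<close>.\<close>

lemma cutoff_energy_le:
  assumes g: "g holomorphic_on UNIV" and R: "R > 0"
    and M: "\<And>z. norm z \<le> R \<Longrightarrow> norm (g z) \<le> M"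
  shows "integral (cbox (-R, -R) (R, R))
           (\<lambda>(x, y). cutoff ((1 + (x\<^sup>2 + y\<^sup>2)) / R\<^sup>2) * (4 * (spherical_deriv g (Complex x y))\<^sup>2))
         \<le> 32 * ln (1 + M\<^sup>2)"
proof -
  define G G' G'' where "G x y = g (Complex x y)" and "G' x y = deriv g (Complex x y)"
    and "G'' x y = deriv (deriv g) (Complex x y)" for x y
  define D where "D x y = 1 + (norm (G x y))\<^sup>2" for x y
  define u where "u x y = ln (D x y)" for x y
  define u\<^sub>x where "u\<^sub>x x y = 2 * (G x y \<bullet> G' x y) / D x y" for x y
  define u\<^sub>y where "u\<^sub>y x y = 2 * (G x y \<bullet> (\<i> * G' x y)) / D x y" for x y
  define u\<^sub>x\<^sub>x where "u\<^sub>x\<^sub>x x y = 2 * ((norm (G' x y))\<^sup>2 + G x y \<bullet> G'' x y) / D x y - (2 * (G x y \<bullet> G' x y) / D x y)\<^sup>2" for x y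
  define u\<^sub>y\<^sub>y where "u\<^sub>y\<^sub>y x y = 2 * ((norm (\<i> * G' x y))\<^sup>2 + G x y \<bullet> (- G'' x y)) / D x y
      - (2 * (G x y \<bullet> (\<i> * G' x y)) / D x y)\<^sup>2" for x y
  define w where "w x y = (1 + (x\<^sup>2 + y\<^sup>2)) / R\<^sup>2" for x y
  define p where "p x y = cutoff (w x y)" for x y
  define p\<^sub>x where "p\<^sub>x x y = cutoff' (w x y) * (2 * x / R\<^sup>2)" for x y
  define p\<^sub>y where "p\<^sub>y x y = cutoff' (w x y) * (2 * y / R\<^sup>2)" for x y
  define p\<^sub>x\<^sub>x where "p\<^sub>x\<^sub>x x y = cutoff'' (w x y) * (2 * x / R\<^sup>2)\<^sup>2 + cutoff' (w x y) * (2 / R\<^sup>2)" for x y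
  define p\<^sub>y\<^sub>y where "p\<^sub>y\<^sub>y x y = cutoff'' (w x y) * (2 * y / R\<^sup>2)\<^sup>2 + cutoff' (w x y) * (2 / R\<^sup>2)" for x y
  define A where "A x y = u x y * p\<^sub>x\<^sub>x x y - p x y * u\<^sub>x\<^sub>x x y" for x y
  define B where "B x y = u x y * p\<^sub>y\<^sub>y x y - p x y * u\<^sub>y\<^sub>y x y" for x y
  define E where "E x y = p x y * (4 * (spherical_deriv g (Complex x y))\<^sup>2)" for x y
  define L where "L = ln (1 + M\<^sup>2)"

  have g': "deriv g holomorphic_on UNIV" and g'': "deriv (deriv g) holomorphic_on UNIV"
    using g holomorphic_deriv by blast+
  have dg: "(g has_field_derivative deriv g z) (at z)"
    and dg': "(deriv g has_field_derivative deriv (deriv g) z) (at z)" for z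
    using g g' holomorphic_derivI by blast+
  have cx: "((\<lambda>x. Complex x y) has_vector_derivative 1) (at x)" for x y
    unfolding Complex_eq by (auto intro!: derivative_eq_intros)
  have cy: "(Complex x has_vector_derivative \<i>) (at y)" for x y
    unfolding Complex_eq by (auto intro!: derivative_eq_intros)
  have Gx: "((\<lambda>x. G x y) has_vector_derivative G' x y) (at x)"
    and Gy: "(G x has_vector_derivative \<i> * G' x y) (at y)"
    and G'x: "((\<lambda>x. G' x y) has_vector_derivative G'' x y) (at x)"
    and G'y: "((\<lambda>y. \<i> * G' x y) has_vector_derivative - G'' x y) (at y)" for x y
    unfolding G_def G'_def G''_def
    using field_vector_diff_chain_at[OF cx dg] field_vector_diff_chain_at[OF cy dg]
      field_vector_diff_chain_at[OF cx dg'] 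
      has_vector_derivative_mult_right[OF field_vector_diff_chain_at[OF cy dg'], of \<i>]
    by (auto simp: o_def)
  have ux: "((\<lambda>x. u x y) has_real_derivative u\<^sub>x x y) (at x)" "((\<lambda>x. u\<^sub>x x y) has_real_derivative u\<^sub>x\<^sub>x x y) (at x)" for x y
    unfolding u_def u\<^sub>x_def u\<^sub>x\<^sub>x_def D_def
    using log_one_plus_norm_derivs[of "\<lambda>x. G x y" "\<lambda>x. G' x y", OF Gx G'x] by auto
  have uy: "((\<lambda>y. u x y) has_real_derivative u\<^sub>y x y) (at y)" "((\<lambda>y. u\<^sub>y x y) has_real_derivative u\<^sub>y\<^sub>y x y) (at y)" for x y
    unfolding u_def u\<^sub>y_def u\<^sub>y\<^sub>y_def D_def
    using log_one_plus_norm_derivs[of "\<lambda>y. G x y" "\<lambda>y. \<i> * G' x y", OF Gy G'y] by auto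

  have w_pos: "w x y > 0" for x y using R by (simp add: w_def add_pos_nonneg)
  have wx: "((\<lambda>x. w x y) has_real_derivative 2 * x / R\<^sup>2) (at x)" for x y
    unfolding w_def by (rule DERIV_cdivide) (auto intro!: derivative_eq_intros)
  have wy: "((\<lambda>y. w x y) has_real_derivative 2 * y / R\<^sup>2) (at y)" for x y
    unfolding w_def by (rule DERIV_cdivide) (auto intro!: derivative_eq_intros)
  have px: "((\<lambda>x. p x y) has_real_derivative p\<^sub>x x y) (at x)" for x y
    unfolding p_def p\<^sub>x_def by (rule DERIV_chain2[OF cutoff_deriv[OF w_pos] wx])
  have py: "((\<lambda>y. p x y) has_real_derivative p\<^sub>y x y) (at y)" for x y
    unfolding p_def p\<^sub>y_def by (rule DERIV_chain2[OF cutoff_deriv[OF w_pos] wy])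
  have pxx: "((\<lambda>x. p\<^sub>x x y) has_real_derivative p\<^sub>x\<^sub>x x y) (at x)" for x y
    unfolding p\<^sub>x_def p\<^sub>x\<^sub>x_def
    by (rule DERIV_cong[OF DERIV_mult[OF DERIV_chain2[OF cutoff'_deriv[OF w_pos] wx]
            DERIV_cdivide[OF DERIV_cmult_Id]]])
       (simp add: power2_eq_square mult_ac)
  have pyy: "((\<lambda>y. p\<^sub>y x y) has_real_derivative p\<^sub>y\<^sub>y x y) (at y)" for x y
    unfolding p\<^sub>y_def p\<^sub>y\<^sub>y_def
    by (rule DERIV_cong[OF DERIV_mult[OF DERIV_chain2[OF cutoff'_deriv[OF w_pos] wy]
            DERIV_cdivide[OF DERIV_cmult_Id]]])
       (simp add: power2_eq_square mult_ac)
  have w_edge: "w x y \<ge> 1" "w y x \<ge> 1" if "x\<^sup>2 = R\<^sup>2" for x y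
    using that R by (simp_all add: w_def)

  \<comment> \<open>The boundary terms vanish: outside the open disc of radius \<open>R\<close>, in particular on the edges of
    the square, the test function and its gradient are 0.\<close>
  have Ax: "((\<lambda>x. A x y) has_integral 0) {-R..R}" for y
    unfolding A_def
    by (rule green_interval[OF _ ux px pxx])
       (use R w_edge[of R y] w_edge[of "-R" y] in \<open>auto simp: p_def p\<^sub>x_def cutoff_outside\<close>)
  have By: "(B x has_integral 0) {-R..R}" for x
    unfolding B_def
    by (rule green_interval[OF _ uy py pyy])
       (use R w_edge[of R x] w_edge[of "-R" x] in \<open>auto simp: p_def p\<^sub>y_def cutoff_outside\<close>)

  have cC: "continuous_on UNIV (\<lambda>q. Complex (fst q) (snd q))"
    unfolding Complex_eq by (intro continuous_intros)
  have cG: "continuous_on UNIV (\<lambda>q. G (fst q) (snd q))" "continuous_on UNIV (\<lambda>q. G' (fst q) (snd q))"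
    "continuous_on UNIV (\<lambda>q. G'' (fst q) (snd q))"
    unfolding G_def G'_def G''_def
    using g g' g'' by (auto intro!: continuous_on_compose2[OF holomorphic_on_imp_continuous_on cC])
  have cw: "continuous_on UNIV (\<lambda>q. w (fst q) (snd q))"
    unfolding w_def using R by (intro continuous_intros) auto
  have c0: "continuous_on {0<..} cutoff" "continuous_on {0<..} cutoff'"
    using cutoff_deriv cutoff'_deriv by (meson DERIV_isCont continuous_at_imp_continuous_on greaterThan_iff)+
  have cp: "continuous_on UNIV (\<lambda>q. cutoff (w (fst q) (snd q)))" 
    "continuous_on UNIV (\<lambda>q. cutoff' (w (fst q) (snd q)))" 
    "continuous_on UNIV (\<lambda>q. cutoff'' (w (fst q) (snd q)))"
    by (rule continuous_on_compose2[OF c0(1) cw] continuous_on_compose2[OF c0(2) cw]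
          continuous_on_compose2[OF cutoff''_continuous cw]; use w_pos in auto)+
  have D_pos: "D x y > 0" for x y by (simp add: D_def add_pos_nonneg)
  have D_nz: "D x y \<noteq> 0" for x y using D_pos[of x y] by simp
  have cD: "continuous_on UNIV (\<lambda>q. D (fst q) (snd q))"
    unfolding D_def by (intro continuous_intros cG)
  have cA: "continuous_on UNIV (\<lambda>(x, y). A x y)"
    unfolding A_def u_def p_def p\<^sub>x\<^sub>x_def u\<^sub>x\<^sub>x_def case_prod_unfold
    by (intro continuous_intros cG cp cD) (use D_pos D_nz R in auto)
  have cB: "continuous_on UNIV (\<lambda>(x, y). B x y)"
    unfolding B_def u_def p_def p\<^sub>y\<^sub>y_def u\<^sub>y\<^sub>y_def case_prod_unfold
    by (intro continuous_intros cG cp cD) (use D_pos D_nz R in auto)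
  have E_eq: "E x y = p x y * (4 * (norm (G' x y) / D x y)\<^sup>2)" for x y
    by (simp add: E_def spherical_deriv_def G'_def G_def D_def)
  have cE: "continuous_on UNIV (\<lambda>(x, y). E x y)"
    unfolding E_eq p_def case_prod_unfold
    by (intro continuous_intros cG cp cD) (use D_nz in auto)

  \<comment> \<open>Pointwise form of \<open>p \<Delta>u + (u \<Delta>p - p \<Delta>u) = u \<Delta>p\<close>.\<close>
  have lap: "E x y + (A x y + B x y) = u x y * (p\<^sub>x\<^sub>x x y + p\<^sub>y\<^sub>y x y)" for x y
  proof -
    have "u\<^sub>x\<^sub>x x y + u\<^sub>y\<^sub>y x y = 4 * (norm (G' x y) / D x y)\<^sup>2"
      unfolding u\<^sub>x\<^sub>x_def u\<^sub>y\<^sub>y_def D_def by (rule log_one_plus_norm_laplacian)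
    then show ?thesis
      unfolding A_def B_def E_eq by (simp add: algebra_simps flip: distrib_left)
  qed
  have L0: "L \<ge> 0" by (simp add: L_def)
  \<comment> \<open>The Laplacian of \<open>p\<close> may be very negative, but \<open>u \<ge> 0\<close>, so only its upper bound matters. Where it is
    nonzero, \<open>|z| \<le> R\<close> and hence \<open>u \<le> L\<close>.\<close>
  have le: "E x y + (A x y + B x y) \<le> L * (8 / R\<^sup>2)" for x y
  proof (cases "w x y \<ge> 1")
    case True
    then have "p\<^sub>x\<^sub>x x y + p\<^sub>y\<^sub>y x y = 0" by (simp add: p\<^sub>x\<^sub>x_def p\<^sub>y\<^sub>y_def cutoff_outside)
    then show ?thesis unfolding lap using L0 by simp
  next
    case False
    have u0: "u x y \<ge> 0" by (simp add: u_def D_def)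
    have "x\<^sup>2 + y\<^sup>2 \<le> R\<^sup>2" using False R by (simp add: w_def field_simps)
    then have "norm (Complex x y) \<le> R" using R by (simp add: cmod_def real_le_lsqrt)
    then have "norm (G x y) \<le> M" unfolding G_def by (rule M)
    then have "(norm (G x y))\<^sup>2 \<le> M\<^sup>2" by (intro power_mono) auto
    then have uL: "u x y \<le> L" unfolding u_def L_def D_def by (simp add: add_pos_nonneg)
    have "p\<^sub>x\<^sub>x x y + p\<^sub>y\<^sub>y x y
        = cutoff'' (w x y) * (4 * (x\<^sup>2 + y\<^sup>2) / (R\<^sup>2)\<^sup>2) + cutoff' (w x y) * (4 / R\<^sup>2)"
      unfolding p\<^sub>x\<^sub>x_def p\<^sub>y\<^sub>y_def by (simp add: power_divide power_mult_distrib algebra_simps add_divide_distrib)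
    also have "\<dots> \<le> 8 / R\<^sup>2"
      unfolding w_def using R by (intro cutoff_laplacian_le) auto
    finally have "u x y * (p\<^sub>x\<^sub>x x y + p\<^sub>y\<^sub>y x y) \<le> u x y * (8 / R\<^sup>2)"
      using u0 by (rule mult_left_mono)
    also have "\<dots> \<le> L * (8 / R\<^sup>2)" using uL by (intro mult_right_mono) auto
    finally show ?thesis unfolding lap .
  qed

  let ?Q = "cbox (-R, -R) (R, R)"
  have int: "(\<lambda>(x, y). A x y) integrable_on ?Q" "(\<lambda>(x, y). B x y) integrable_on ?Q" "(\<lambda>(x, y). E x y) integrable_on ?Q"
    using cA cB cE by (auto intro!: integrable_continuous intro: continuous_on_subset)
  have "integral ?Q (\<lambda>(x, y). E x y)
      = integral ?Q (\<lambda>(x, y). E x y) + (integral ?Q (\<lambda>(x, y). A x y) + integral ?Q (\<lambda>(x, y). B x y))"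
    using integral_square_eq_0[OF cA] integral_square_eq_0[OF cB] Ax By by simp
  also have "\<dots> = integral ?Q (\<lambda>q. (\<lambda>(x, y). E x y) q + ((\<lambda>(x, y). A x y) q + (\<lambda>(x, y). B x y) q))"
    using int by (simp add: integral_add integrable_add)
  also have "\<dots> \<le> integral ?Q (\<lambda>q. L * (8 / R\<^sup>2))"
    using int le by (intro integral_le integrable_add integrable_const) auto
  also have "\<dots> = 32 * L"
    using R by (simp add: content_Pair power2_eq_square)
  finally show ?thesis unfolding E_def p_def w_def L_def .
qed

section \<open>Spherical area and maximum modulus\<close>

text \<open>On \<open>U\<close> the test function is at least 8, so 32 times the integrand of the area is dominated by the
integrand of \<open>cutoff_energy_le\<close>, and the two factors 32 cancel. The rest of the proof passes from the
Lebesgue integral over the complex plane to the integral over the square in real coordinates.\<close>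

lemma spherical_area_le_log:
  assumes g: "g holomorphic_on UNIV" and U: "open U" "U \<subseteq> cball 0 r"
    and R: "R > 0" "exp 10 * (1 + r\<^sup>2) \<le> R\<^sup>2"
    and M: "\<And>z. norm z \<le> R \<Longrightarrow> norm (g z) \<le> M"
  shows "pi * spherical_area U g \<le> ln (1 + M\<^sup>2)"
proof -
  define F where "F z = cutoff ((1 + (norm z)\<^sup>2) / R\<^sup>2) * (4 * (spherical_deriv g z)\<^sup>2)" for z
  define Q where "Q = cbox (Complex (-R) (-R)) (Complex R R)"
  have "r\<^sup>2 \<le> 1 * (1 + r\<^sup>2)" by simp
  also have "\<dots> \<le> exp 10 * (1 + r\<^sup>2)" by (intro mult_right_mono) auto
  also note R(2)
  finally have rR: "r\<^sup>2 \<le> R\<^sup>2" .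
  have rR': "norm z \<le> R" "32 * (spherical_deriv g z)\<^sup>2 \<le> F z" if "z \<in> U" for z
  proof -
    have z: "(norm z)\<^sup>2 \<le> r\<^sup>2" using that U by (intro power_mono) auto
    then have "(norm z)\<^sup>2 \<le> R\<^sup>2" using rR by linarith
    then show "norm z \<le> R" using R by (meson less_eq_real_def power2_le_imp_le)
    have "exp 10 * (1 + (norm z)\<^sup>2) \<le> exp 10 * (1 + r\<^sup>2)" using z by simp
    then have "exp 10 * (1 + (norm z)\<^sup>2) \<le> R\<^sup>2" using R by linarith
    then have "cutoff ((1 + (norm z)\<^sup>2) / R\<^sup>2) \<ge> 8"
      using R by (intro cutoff_ge) (auto simp: exp_minus field_simps add_pos_nonneg)
    then have "8 * (4 * (spherical_deriv g z)\<^sup>2) \<le> F z"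
      unfolding F_def by (intro mult_right_mono) auto
    then show "32 * (spherical_deriv g z)\<^sup>2 \<le> F z" by simp
  qed
  have pos: "1 + (norm (g z))\<^sup>2 \<noteq> 0" for z
    using zero_le_power2[of "norm (g z)"] by linarith
  have pos': "(1 + (norm z)\<^sup>2) / R\<^sup>2 > 0" for z :: complex using R by (simp add: add_pos_nonneg)
  have "continuous_on {0<..} cutoff"
    using cutoff_deriv by (meson DERIV_isCont continuous_at_imp_continuous_on greaterThan_iff)
  then have cc: "continuous_on UNIV (\<lambda>z::complex. cutoff ((1 + (norm z)\<^sup>2) / R\<^sup>2))"
    by (rule continuous_on_compose2) (use pos' R in \<open>auto intro!: continuous_intros\<close>)
  have cg: "continuous_on UNIV g" "continuous_on UNIV (deriv g)"
    using g by (auto intro: holomorphic_on_imp_continuous_on holomorphic_deriv)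
  have cF: "continuous_on UNIV F"
    unfolding F_def spherical_deriv_def by (intro continuous_intros cc cg) (use pos in auto)
  have F0: "F z \<ge> 0" for z unfolding F_def using cutoff_nonneg[OF pos'] by simp
  have UQ: "U \<subseteq> Q"
  proof
    fix z assume "z \<in> U"
    then have "norm z \<le> R" by (rule rR')
    then have "\<bar>Re z\<bar> \<le> R" "\<bar>Im z\<bar> \<le> R" using abs_Re_le_cmod abs_Im_le_cmod by (meson order_trans)+
    then show "z \<in> Q" by (auto simp: Q_def in_cbox_complex_iff)
  qed
  have bU: "bounded U" using U bounded_subset bounded_cball by blast
  have iQ: "set_integrable lborel Q F"
    unfolding Q_def set_integrable_def
    using borel_integrable_compact[of Q F] cF continuous_on_subset 
    by (metis (no_types, lifting) Bochner_Integration.integrable_cong Q_def compact_cbox indicator_simps scaleR_one scaleR_zero_left top_greatest)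
  have "32 * (pi * spherical_area U g) = (LINT z:U|lborel. 32 * (spherical_deriv g z)\<^sup>2)"
    by (simp add: spherical_area_def)
  also have "\<dots> \<le> (LINT z:Q|lborel. F z)"
    unfolding set_lebesgue_integral_def
  proof (rule integral_mono)
    show "integrable lborel (\<lambda>z. indicator U z *\<^sub>R (32 * (spherical_deriv g z)\<^sup>2))"
      using set_integrable_mult_right[OF spherical_area_integrable[OF g bU U(1)], of 32]
      by (simp add: set_integrable_def)
    show "integrable lborel (\<lambda>z. indicator Q z *\<^sub>R F z)" using iQ by (simp add: set_integrable_def)
    show "indicator U z *\<^sub>R (32 * (spherical_deriv g z)\<^sup>2) \<le> indicator Q z *\<^sub>R F z" for z
      using UQ rR'(2)[of z] F0[of z] by (auto simp: indicator_def)
  qed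
  also have "\<dots> = (LINT q:cbox (-R, -R) (R, R)|lborel. F (Complex (fst q) (snd q)))"
  proof -
    have [measurable]: "F \<in> borel_measurable borel" by (rule borel_measurable_continuous_onI[OF cF])
    have [measurable]: "(\<lambda>(x, y). Complex x y) \<in> borel_measurable borel"
      unfolding case_prod_unfold Complex_eq by (intro borel_measurable_continuous_onI continuous_intros)
    have [measurable]: "Q \<in> sets borel" by (simp add: Q_def)
    have "(LINT z:Q|lborel. F z) = (LINT q|lborel. indicator Q (case q of (x, y) \<Rightarrow> Complex x y) *\<^sub>R F (case q of (x, y) \<Rightarrow> Complex x y))"
      unfolding set_lebesgue_integral_def by (subst lborel_complex, subst integral_distr) auto
    also have "\<dots> = (LINT q:cbox (-R, -R) (R, R)|lborel. F (Complex (fst q) (snd q)))"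
      unfolding set_lebesgue_integral_def
      by (intro Bochner_Integration.integral_cong refl)
         (auto simp: Q_def in_cbox_complex_iff indicator_def cbox_Pair_eq)
    finally show ?thesis .
  qed
  also have "\<dots> = integral (cbox (-R, -R) (R, R)) (\<lambda>q. F (Complex (fst q) (snd q)))"
  proof (rule set_borel_integral_eq_integral)
    have c: "continuous_on (cbox (-R, -R) (R, R)) (\<lambda>q. F (Complex (fst q) (snd q)))"
      unfolding Complex_eq by (rule continuous_on_compose2[OF cF]) (auto intro!: continuous_intros)
    show "set_integrable lborel (cbox (-R, -R) (R, R)) (\<lambda>q. F (Complex (fst q) (snd q)))"
      using borel_integrable_compact[OF compact_cbox c]
      unfolding set_integrable_def
      by (metis (no_types, lifting) Bochner_Integration.integrable_cong indicator_simps scaleR_one scaleR_zero_left)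
  qed
  also have "\<dots> \<le> 32 * ln (1 + M\<^sup>2)"
    using cutoff_energy_le[OF g R(1) M] by (simp add: F_def case_prod_unfold cmod_def)
  finally show ?thesis by simp
qed

section \<open>Iterated maximum modulus\<close>

lemma norm_le_max_modulus:
  assumes f: "f holomorphic_on UNIV" and z: "norm z \<le> s"
  shows "norm (f z) \<le> max_modulus s f"
proof (rule maximum_modulus_frontier[of f "cball 0 s"])
  have c: "continuous_on UNIV f" using f by (rule holomorphic_on_imp_continuous_on)
  show "f holomorphic_on interior (cball 0 s)" using f holomorphic_on_subset by blast
  show "continuous_on (closure (cball 0 s)) f" using c continuous_on_subset by blast
  fix w assume "w \<in> frontier (cball (0::complex) s)"
  moreover have "s \<ge> 0" using z norm_ge_zero order_trans by blast
  ultimately show "norm (f w) \<le> max_modulus s f"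
    using max_modulus_attained[OF c, of s] by auto
qed (use z in auto)

lemma norm_funpow_le_iter_max_modulus:
  assumes "f holomorphic_on UNIV" "norm z \<le> R"
  shows "norm ((f ^^ n) z) \<le> iter_max_modulus n R f"
proof (induction n)
  case 0
  show ?case using assms(2) by (simp add: iter_max_modulus_def)
next
  case (Suc n)
  then show ?case
    using norm_le_max_modulus[OF assms(1)] by (simp only: iter_max_modulus_Suc funpow.simps o_apply)
qed

lemma max_modulus_mono:
  assumes f: "f holomorphic_on UNIV" and "0 \<le> r" "r \<le> s"
  shows "max_modulus r f \<le> max_modulus s f"
proof -
  obtain z where "norm z = r" "norm (f z) = max_modulus r f"
    using max_modulus_attained[OF holomorphic_on_imp_continuous_on[OF f] assms(2)] by auto
  then show ?thesis using norm_le_max_modulus[OF f, of z s] assms by simp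
qed

lemma iter_max_modulus_ge:
  assumes f: "f holomorphic_on UNIV" and "0 \<le> R" "R \<le> max_modulus R f"
  shows "R \<le> iter_max_modulus n R f"
proof (induction n)
  case (Suc n)
  have "R \<le> max_modulus R f" by fact
  also have "\<dots> \<le> max_modulus (iter_max_modulus n R f) f"
    by (rule max_modulus_mono[OF f assms(2) Suc])
  finally show ?case by (simp add: iter_max_modulus_Suc)
qed (simp add: iter_max_modulus_def)

text \<open>Otherwise \<open>|f z| \<le> |z|\<close> for all large \<open>z\<close>, and Liouville's theorem in its polynomial form makes \<open>f\<close> a
polynomial of degree at most 1.\<close>

lemma transcendental_max_modulus_ge:
  assumes f: "transcendental_entire f"
  shows "\<exists>R\<ge>R\<^sub>0. R \<le> max_modulus R f"
proof (rule ccontr)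
  assume "\<not> ?thesis"
  then have lt: "max_modulus R f < R" if "R \<ge> R\<^sub>0" for R using that by force
  have hol: "f holomorphic_on UNIV" using f by (simp add: transcendental_entire_def)
  have "norm (f z) \<le> 1 * norm z ^ 1" if "R\<^sub>0 \<le> norm z" for z
    using lt[OF that] norm_le_max_modulus[OF hol, of z "norm z"] by simp
  then have taylor: "f z = (\<Sum>k\<le>1. (deriv ^^ k) f 0 / fact k * z ^ k)" for z
    by (rule Liouville_polynomial[OF hol])
  have "(\<Sum>k\<le>1. (deriv ^^ k) f 0 / fact k * z ^ k) = poly [:f 0, deriv f 0:] z" for z
    by simp
  then have "f = poly [:f 0, deriv f 0:]"
    by (intro ext) (rule trans[OF taylor])
  then show False using f unfolding transcendental_entire_def by blast
qed

lemma funpow_holomorphic: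
  assumes "f holomorphic_on UNIV" shows "(f ^^ n) holomorphic_on UNIV"
proof (induction n)
  case (Suc n)
  then show ?case using holomorphic_on_compose_gen[OF Suc assms] by (simp add: o_def)
qed (simp add: id_def)

theorem theorem1p3:
  fixes f :: "complex \<Rightarrow> complex" and U :: "complex set"
  assumes "transcendental_entire f"
    and "open U" and "bounded U"
  shows "\<exists>R>0. \<forall>n\<ge>1. spherical_area U (f ^^ n) \<le> ln (iter_max_modulus n R f)"
proof -
  have f: "f holomorphic_on UNIV" using assms(1) by (simp add: transcendental_entire_def)
  obtain r where r: "U \<subseteq> cball 0 r" using assms(3) bounded_subset_ballD[of U 0] ball_subset_cball by (meson subset_trans)
  \<comment> \<open>Large enough that \<open>R \<ge> 2\<close>, and hence \<open>exp 10 * (1 + r\<^sup>2) \<le> R \<le> R\<^sup>2\<close>, for all \<open>R \<ge> R\<^sub>0\<close>.\<close>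
  define R\<^sub>0 where "R\<^sub>0 = 2 + exp 10 * (1 + r\<^sup>2)"
  obtain R where R: "R \<ge> R\<^sub>0" "R \<le> max_modulus R f"
    using transcendental_max_modulus_ge[OF assms(1)] by blast
  have "exp 10 * (1 + r\<^sup>2) \<ge> 0" by simp
  then have R2: "R \<ge> 2" "exp 10 * (1 + r\<^sup>2) \<le> R" using R(1) unfolding R\<^sub>0_def by linarith+
  have "R * 1 \<le> R * R" using R2 by (intro mult_left_mono) auto
  then have RR: "exp 10 * (1 + r\<^sup>2) \<le> R\<^sup>2" using R2 unfolding power2_eq_square[of R] by linarith
  have "spherical_area U (f ^^ n) \<le> ln (iter_max_modulus n R f)" for n
  proof -
    define M where "M = iter_max_modulus n R f"
    have M: "M \<ge> 2" unfolding M_def using iter_max_modulus_ge[OF f _ R(2), of n] R2 by linarith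
    have "pi * spherical_area U (f ^^ n) \<le> ln (1 + M\<^sup>2)"
      by (rule spherical_area_le_log[OF funpow_holomorphic[OF f] assms(2) r _ RR])
         (use R2 norm_funpow_le_iter_max_modulus[OF f] in \<open>auto simp: M_def\<close>)
    also have "\<dots> \<le> ln (M ^ 3)"
    proof -
      have "1 \<le> M\<^sup>2" using M by (simp add: one_le_power)
      moreover have "2 * M\<^sup>2 \<le> M * M\<^sup>2" using M by (intro mult_right_mono) auto
      ultimately have "1 + M\<^sup>2 \<le> M ^ 3" by (simp add: power3_eq_cube power2_eq_square)
      then show ?thesis by (intro ln_mono) (auto simp: add_pos_nonneg)
    qed
    also have "\<dots> = 3 * ln M" using M by (simp add: ln_realpow)
    also have "\<dots> \<le> pi * ln M" using M pi_gt3 by (intro mult_right_mono) auto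
    finally show ?thesis by (simp add: M_def)
  qed
  then show ?thesis using R2 by (intro exI[of _ R]) auto
qed

end
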